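(* Let $\gamma(x)=1/x$ and let $G$ be a star with internal node $u$ of degree $d_u$, where $3\le d_u<\infty$, with arbitrary strictly positive initial edge weights $\vec w(0)$ satisfying $\sum_{e\in E(G)}w_e(0)=1$. Then the normalized Ricci flow $$\frac{dw_e}{dt}=-\kappa_e w_e+w_e\sum_{h\in E(G)}\kappa_h w_h\qquad(e\in E(G))$$ with initial condition $\vec w(0)$ deforms the weights to the constant weight $\frac1{d_u}$, i.e. $\lim_{t\to\infty}w_e(t)=\frac{1}{d_u}$ for every edge $e$ of $G$.
   Context: A star is a tree with one internal node $u$, all other vertices being leaves adjacent to $u$. Weighted graph: $G=(V,E,w)$ with $w_{xy}>0$ for each edge $xy\in E$; $d(x,y)$ is the minimal total weight of a path joining $x$ and $y$. Write $x\sim y$ if $xy\in E$. For $\alpha\in[0,1]$ and $x\in V$, let $\mu_x^\alpha$ be the probability distribution on $V$ with $\mu_x^\alpha(x)=\alpha$, $\mu_x^\alpha(y)=(1-\alpha)\dfrac{\gamma(w_{xy})}{\sum_{z\sim x}\gamma(w_{xz})}$ if $y\sim x$, and $\mu_x^\alpha(y)=0$ otherwise. Let $W(\mu_1,\mu_2)=\inf_A\sum_{x,y\in V}A(x,y)d(x,y)$, the infimum being over all couplings $A$ of $\mu_1$ and $\mu_2$. For $x\ne y$ set $\kappa_\alpha(x,y)=1-\dfrac{W(\mu_x^\alpha,\mu_y^\alpha)}{d(x,y)}$. The Ollivier-Lin-Lu-Yau curvature is $\kappa(x,y)=\lim_{\alpha\to1}\dfrac{\kappa_\alpha(x,y)}{1-\alpha}$.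 For an edge $e=xy$, $\kappa_e=\kappa(x,y)$, computed at time $t$ with the weights $w(t)$. *)

theory Defs
  imports Complex_Main
begin

text \<open>
  Graphs are given by a vertex set \<open>V\<close> and a set \<open>E\<close> of two-element subsets of \<open>V\<close>;
  edge weights are functions on such sets, of which only the values on \<open>E\<close> matter.
\<close>

definition simple_graph :: "'a set \<Rightarrow> 'a set set \<Rightarrow> bool" where
  "simple_graph V E \<longleftrightarrow> (\<forall>e\<in>E. \<exists>x\<in>V. \<exists>y\<in>V. x \<noteq> y \<and> e = {x, y})"

definition neighbours :: "'a set set \<Rightarrow> 'a \<Rightarrow> 'a set" where
  "neighbours E x = {y. {x, y} \<in> E}"

definition vertex_degree :: "'a set set \<Rightarrow> 'a \<Rightarrow> nat" where
  "vertex_degree E x = card (neighbours E x)"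

definition graph_path :: "'a set \<Rightarrow> 'a set set \<Rightarrow> 'a list \<Rightarrow> bool" where
  "graph_path V E p \<longleftrightarrow>
     p \<noteq> [] \<and> set p \<subseteq> V \<and> distinct p \<and> successively (\<lambda>x y. {x, y} \<in> E) p"

definition paths_between :: "'a set \<Rightarrow> 'a set set \<Rightarrow> 'a \<Rightarrow> 'a \<Rightarrow> 'a list set" where
  "paths_between V E x y = {p. graph_path V E p \<and> hd p = x \<and> last p = y}"

definition connected_graph :: "'a set \<Rightarrow> 'a set set \<Rightarrow> bool" where
  "connected_graph V E \<longleftrightarrow> (\<forall>x\<in>V. \<forall>y\<in>V. paths_between V E x y \<noteq> {})"

text \<open>A cycle is represented by its list of vertices, without repeating the first one.\<close>

definition graph_cycle :: "'a set \<Rightarrow> 'a set set \<Rightarrow> 'a list \<Rightarrow> bool" where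
  "graph_cycle V E p \<longleftrightarrow> graph_path V E p \<and> 3 \<le> length p \<and> {last p, hd p} \<in> E"

definition tree_graph :: "'a set \<Rightarrow> 'a set set \<Rightarrow> bool" where
  "tree_graph V E \<longleftrightarrow>
     simple_graph V E \<and> V \<noteq> {} \<and> connected_graph V E \<and> (\<nexists>p. graph_cycle V E p)"

definition leaf_vertex :: "'a set set \<Rightarrow> 'a \<Rightarrow> bool" where
  "leaf_vertex E x \<longleftrightarrow> vertex_degree E x = 1"

definition star_graph :: "'a set \<Rightarrow> 'a set set \<Rightarrow> 'a \<Rightarrow> bool" where
  "star_graph V E u \<longleftrightarrow>
     tree_graph V E \<and> u \<in> V \<and> \<not> leaf_vertex E u \<and>
     (\<forall>v\<in>V - {u}. leaf_vertex E v \<and> {u, v} \<in> E)"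

text \<open>
  The remaining definitions are meant for finite connected graphs with positive weights on the
  edges. Then there are finitely many paths between two vertices, so the infimum defining the
  distance is a minimum, and all sums are finite.
\<close>

definition path_weight :: "('a set \<Rightarrow> real) \<Rightarrow> 'a list \<Rightarrow> real" where
  "path_weight w p = (\<Sum>i<length p - 1. w {p ! i, p ! Suc i})"

definition graph_dist :: "'a set \<Rightarrow> 'a set set \<Rightarrow> ('a set \<Rightarrow> real) \<Rightarrow> 'a \<Rightarrow> 'a \<Rightarrow> real" where
  "graph_dist V E w x y = (INF p\<in>paths_between V E x y. path_weight w p)"

definition lazy_walk ::
  "(real \<Rightarrow> real) \<Rightarrow> 'a set set \<Rightarrow> ('a set \<Rightarrow> real) \<Rightarrow> real \<Rightarrow> 'a \<Rightarrow> 'a \<Rightarrow> real" where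
  "lazy_walk \<gamma> E w \<alpha> x y =
     (if y = x then \<alpha>
      else if {x, y} \<in> E then (1 - \<alpha>) * (\<gamma> (w {x, y}) / (\<Sum>z\<in>neighbours E x. \<gamma> (w {x, z})))
      else 0)"

definition couplings :: "'a set \<Rightarrow> ('a \<Rightarrow> real) \<Rightarrow> ('a \<Rightarrow> real) \<Rightarrow> ('a \<Rightarrow> 'a \<Rightarrow> real) set" where
  "couplings V \<mu> \<nu> =
     {A. (\<forall>x\<in>V. \<forall>y\<in>V. 0 \<le> A x y) \<and>
         (\<forall>x\<in>V. (\<Sum>y\<in>V. A x y) = \<mu> x) \<and>
         (\<forall>y\<in>V. (\<Sum>x\<in>V. A x y) = \<nu> y)}"

definition wasserstein ::
  "'a set \<Rightarrow> 'a set set \<Rightarrow> ('a set \<Rightarrow> real) \<Rightarrow> ('a \<Rightarrow> real) \<Rightarrow> ('a \<Rightarrow> real) \<Rightarrow> real" where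
  "wasserstein V E w \<mu> \<nu> =
     (INF A\<in>couplings V \<mu> \<nu>. \<Sum>x\<in>V. \<Sum>y\<in>V. A x y * graph_dist V E w x y)"

definition alpha_curvature ::
  "(real \<Rightarrow> real) \<Rightarrow> 'a set \<Rightarrow> 'a set set \<Rightarrow> ('a set \<Rightarrow> real) \<Rightarrow> real \<Rightarrow> 'a \<Rightarrow> 'a \<Rightarrow> real" where
  "alpha_curvature \<gamma> V E w \<alpha> x y =
     1 - wasserstein V E w (lazy_walk \<gamma> E w \<alpha> x) (lazy_walk \<gamma> E w \<alpha> y) / graph_dist V E w x y"

text \<open>The limit is one-sided because the idleness \<open>\<alpha>\<close> ranges over \<open>[0, 1]\<close>.\<close>

definition olly_curvature ::
  "(real \<Rightarrow> real) \<Rightarrow> 'a set \<Rightarrow> 'a set set \<Rightarrow> ('a set \<Rightarrow> real) \<Rightarrow> 'a \<Rightarrow> 'a \<Rightarrow> real" where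
  "olly_curvature \<gamma> V E w x y =
     Lim (at_left 1) (\<lambda>\<alpha>. alpha_curvature \<gamma> V E w \<alpha> x y / (1 - \<alpha>))"

text \<open>The curvature is symmetric in the two vertices, so it has a common value on an edge.\<close>

definition edge_curvature ::
  "(real \<Rightarrow> real) \<Rightarrow> 'a set \<Rightarrow> 'a set set \<Rightarrow> ('a set \<Rightarrow> real) \<Rightarrow> 'a set \<Rightarrow> real" where
  "edge_curvature \<gamma> V E w e =
     (THE k. \<exists>x y. e = {x, y} \<and> x \<noteq> y \<and> k = olly_curvature \<gamma> V E w x y)"

text \<open>
  A solution of the normalized flow on \<open>[0, \<infinity>)\<close>. Positivity is part of the notion, since the
  curvature at time \<open>t\<close> is that of the graph weighted by \<open>w t\<close>; at \<open>t = 0\<close> the derivative is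
  one-sided.
\<close>

definition normalized_ricci_flow ::
  "(real \<Rightarrow> real) \<Rightarrow> 'a set \<Rightarrow> 'a set set \<Rightarrow> (real \<Rightarrow> 'a set \<Rightarrow> real) \<Rightarrow> bool" where
  "normalized_ricci_flow \<gamma> V E w \<longleftrightarrow>
     (\<forall>t\<ge>0. \<forall>e\<in>E. 0 < w t e \<and>
        ((\<lambda>s. w s e) has_real_derivative
           (- edge_curvature \<gamma> V E (w t) e * w t e
            + w t e * (\<Sum>h\<in>E. edge_curvature \<gamma> V E (w t) h * w t h)))
          (at t within {0..}))"

end

theory Submission
  imports Defs
begin

text \<open>
  On a star every quantity of the flow is explicit. Let \<open>d\<close> be the degree of the centre \<open>u\<close>, let
  \<open>x\<^sub>v\<close> be the weight of the edge from \<open>u\<close> to the leaf \<open>v\<close>, and let \<open>S\<close> be the sum of the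
  \<open>1 / x\<^sub>v\<close>. Since \<open>\<gamma>(x) = 1 / x\<close>, a walk leaving \<open>u\<close> puts mass \<open>(1 - \<alpha>) / (x\<^sub>v S)\<close> on the
  leaf \<open>v\<close>, so carrying that mass along its edge costs \<open>(1 - \<alpha>) / S\<close>, the same for every leaf.
  Comparing with the walk from one leaf gives \<open>\<kappa>\<^sub>v = 1 - (d - 2) / (S x\<^sub>v)\<close>
  (\<open>wasserstein_star\<close>, \<open>edge_curvature_star\<close>), and the flow becomes
  \<open>x\<^sub>v' = H - x\<^sub>v + x\<^sub>v (\<Sum>x - d H)\<close> with \<open>H = (d - 2) / S\<close>
  (\<open>normalized_ricci_flow_star_iff\<close>).

  Adding these equations shows that \<open>\<Sum>x - 1\<close> solves a homogeneous linear equation; it vanishes at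
  time 0, so the total weight stays 1 (\<open>star_flow_total_weight\<close>). On that simplex the system
  is \<open>(x\<^sub>v - 1 / d)' = - d H (x\<^sub>v - 1 / d)\<close>: all deviations from \<open>1 / d\<close> shrink by one common
  factor. No weight ever crosses \<open>1 / d\<close>, so all weights stay above a positive constant, hence \<open>H\<close>
  is bounded below, and because \<open>d \<ge> 3\<close> the deviations decay exponentially
  (\<open>simplex_flow_tendsto\<close>).

  The common factor also gives existence (\<open>simplex_flow_exists\<close>). Writing it as \<open>exp (- \<tau>)\<close>, the
  system reduces to one autonomous scalar equation for \<open>\<tau>\<close>, which is solved by separation of
  variables: \<open>\<tau>\<close> is obtained by inverting an explicit increasing function.
\<close>

section \<open>Paths and distances in a star\<close>

lemma star_graph_structure:
  assumes "star_graph V E u"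
  shows "E = (\<lambda>v. {u, v}) ` (V - {u})" and "neighbours E u = V - {u}" and "u \<in> V"
proof -
  have simple: "simple_graph V E" and uV: "u \<in> V"
    and nb: "\<And>v. v \<in> V - {u} \<Longrightarrow> card (neighbours E v) = 1 \<and> {u, v} \<in> E"
    using assms
    by (auto simp: star_graph_def tree_graph_def leaf_vertex_def vertex_degree_def)
  show E: "E = (\<lambda>v. {u, v}) ` (V - {u})"
  proof (intro subset_antisym subsetI)
    fix e assume e: "e \<in> E"
    then obtain x y where xy: "x \<in> V" "y \<in> V" "x \<noteq> y" "e = {x, y}"
      using simple by (auto simp: simple_graph_def)
    show "e \<in> (\<lambda>v. {u, v}) ` (V - {u})"
    proof (cases "x = u \<or> y = u")
      case True
      then show ?thesis using xy by (auto simp: insert_commute)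
    next
      case False
      with nb[of x] xy have "card (neighbours E x) = 1" "{u, x} \<in> E" by auto
      then have "u \<in> neighbours E x" "y \<in> neighbours E x"
        using e xy by (auto simp: neighbours_def insert_commute)
      with \<open>card (neighbours E x) = 1\<close> have "y = u"
        by (metis card_1_singletonE singletonD)
      with False show ?thesis by simp
    qed
  qed (use nb in auto)
  show "neighbours E u = V - {u}"
    by (auto simp: neighbours_def E doubleton_eq_iff)
  show "u \<in> V" by (fact uV)
qed

lemma edge_star_iff:
  assumes "star_graph V E u"
  shows "{a, b} \<in> E \<longleftrightarrow> a = u \<and> b \<in> V - {u} \<or> b = u \<and> a \<in> V - {u}"
proof -
  have "{a, b} \<in> E \<longleftrightarrow> (\<exists>v\<in>V - {u}. {a, b} = {u, v})"
    unfolding star_graph_structure(1)[OF assms] by (rule image_iff)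
  then show ?thesis unfolding doubleton_eq_iff by blast
qed

text \<open>
  The metric of half-lines of a common origin: distinct points are joined only through the origin,
  from which \<open>x\<close> lies at distance \<open>r x\<close>. At most one point is meant to have \<open>r x = 0\<close>.
\<close>

definition hedgehog_dist :: "('a \<Rightarrow> real) \<Rightarrow> 'a \<Rightarrow> 'a \<Rightarrow> real" where
  "hedgehog_dist r x y = (if x = y then 0 else r x + r y)"

lemma graph_dist_star:
  assumes star: "star_graph V E u" and xy: "x \<in> V" "y \<in> V"
  shows "graph_dist V E w x y = hedgehog_dist (\<lambda>v. if v = u then 0 else w {u, v}) x y"
proof -
  note edge = edge_star_iff[OF star]
  define q where "q = (if x = y then [x] else if x = u \<or> y = u then [x, y] else [x, u, y])"
  have path: "p = q" if p: "p \<in> paths_between V E x y" for p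
  proof -
    (* Of two consecutive vertices one is the centre, so four vertices would repeat it. *)
    consider "p = []" | a where "p = [a]" | a b where "p = [a, b]" | a b c where "p = [a, b, c]"
      | a b c d p' where "p = a # b # c # d # p'"
      by (metis neq_Nil_conv)
    then show ?thesis
      using p by cases (auto simp: paths_between_def graph_path_def edge q_def)
  qed
  have "q \<in> paths_between V E x y"
    using xy star_graph_structure(3)[OF star]
    by (auto simp: paths_between_def graph_path_def edge q_def)
  with path have "paths_between V E x y = {q}" by blast
  then show ?thesis
    by (auto simp: graph_dist_def path_weight_def q_def hedgehog_dist_def insert_commute
        numeral_2_eq_2)
qed

section \<open>Transport cost and curvature\<close>

text \<open>
  The easy half of Kantorovich duality: a 1-Lipschitz potential bounds the cost of every coupling
  from below, so a coupling that attains the bound is optimal. This avoids any general duality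
  theorem, provided that an optimal pair can be guessed.
\<close>

lemma wasserstein_eqI:
  assumes A: "A \<in> couplings V \<mu> \<nu>"
    and lip: "\<And>x y. x \<in> V \<Longrightarrow> y \<in> V \<Longrightarrow> f x - f y \<le> graph_dist V E w x y"
    and cost: "(\<Sum>x\<in>V. \<Sum>y\<in>V. A x y * graph_dist V E w x y)
      = (\<Sum>x\<in>V. f x * \<mu> x) - (\<Sum>y\<in>V. f y * \<nu> y)"
  shows "wasserstein V E w \<mu> \<nu> = (\<Sum>x\<in>V. f x * \<mu> x) - (\<Sum>y\<in>V. f y * \<nu> y)"
  unfolding wasserstein_def
proof (rule cInf_eq_minimum)
  show "(\<Sum>x\<in>V. f x * \<mu> x) - (\<Sum>y\<in>V. f y * \<nu> y)
      \<in> (\<lambda>A. \<Sum>x\<in>V. \<Sum>y\<in>V. A x y * graph_dist V E w x y) ` couplings V \<mu> \<nu>"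
    by (rule image_eqI[where x = A]) (simp_all only: A cost)
next
  fix k assume "k \<in> (\<lambda>A. \<Sum>x\<in>V. \<Sum>y\<in>V. A x y * graph_dist V E w x y) ` couplings V \<mu> \<nu>"
  then obtain B where B: "B \<in> couplings V \<mu> \<nu>"
    and k: "k = (\<Sum>x\<in>V. \<Sum>y\<in>V. B x y * graph_dist V E w x y)" by blast
  have "(\<Sum>x\<in>V. f x * \<mu> x) - (\<Sum>y\<in>V. f y * \<nu> y)
      = (\<Sum>x\<in>V. \<Sum>y\<in>V. f x * B x y) - (\<Sum>y\<in>V. \<Sum>x\<in>V. f y * B x y)"
    unfolding sum_distrib_left[symmetric]
    by (intro arg_cong2[where f = "(-)"] sum.cong refl)
      (use B in \<open>auto simp only: couplings_def mem_Collect_eq\<close>)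
  also have "\<dots> = (\<Sum>x\<in>V. \<Sum>y\<in>V. f x * B x y) - (\<Sum>x\<in>V. \<Sum>y\<in>V. f y * B x y)"
    by (subst (2) sum.swap) simp
  also have "\<dots> = (\<Sum>x\<in>V. \<Sum>y\<in>V. B x y * (f x - f y))"
    unfolding sum_subtractf[symmetric] by (intro sum.cong refl) (simp only: algebra_simps)
  also have "\<dots> \<le> k"
    unfolding k using B lip by (intro sum_mono mult_left_mono) (auto simp: couplings_def)
  finally show "(\<Sum>x\<in>V. f x * \<mu> x) - (\<Sum>y\<in>V. f y * \<nu> y) \<le> k" .
qed

lemma wasserstein_commute:
  assumes dist: "\<And>x y. x \<in> V \<Longrightarrow> y \<in> V \<Longrightarrow> graph_dist V E w x y = graph_dist V E w y x"
  shows "wasserstein V E w \<mu> \<nu> = wasserstein V E w \<nu> \<mu>"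
proof -
  let ?cost = "\<lambda>A. \<Sum>x\<in>V. \<Sum>y\<in>V. A x y * graph_dist V E w x y"
  have "?cost ` couplings V \<mu> \<nu> \<subseteq> ?cost ` couplings V \<nu> \<mu>" for \<mu> \<nu>
  proof
    fix k assume "k \<in> ?cost ` couplings V \<mu> \<nu>"
    then obtain A where A: "A \<in> couplings V \<mu> \<nu>" and k: "k = ?cost A" by blast
    have "k = ?cost (\<lambda>x y. A y x)"
      unfolding k by (subst sum.swap) (auto intro!: sum.cong simp: dist)
    moreover have "(\<lambda>x y. A y x) \<in> couplings V \<nu> \<mu>"
      using A by (auto simp: couplings_def)
    ultimately show "k \<in> ?cost ` couplings V \<nu> \<mu>" by (rule image_eqI)
  qed
  then have "?cost ` couplings V \<mu> \<nu> = ?cost ` couplings V \<nu> \<mu>" by (intro subset_antisym)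
  then show ?thesis by (simp add: wasserstein_def)
qed

text \<open>
  In a tree the optimal transport is dictated by the surplus of mass beyond each edge. A leaf
  other than \<open>v\<close> sends its mass to \<open>u\<close>, and across the edge to \<open>v\<close> the net flow goes
  from \<open>u\<close> to \<open>v\<close>, as long as the mass \<open>\<alpha>\<close> needed at \<open>v\<close> exceeds what is already there; the
  assumption \<open>1 / 2 \<le> \<alpha>\<close> guarantees this. Each of the other leaves contributes
  \<open>(1 - \<alpha>) / S\<close>, and the mass already at \<open>v\<close> saves that amount once; this is the factor
  \<open>d - 2 = (d - 1) - 1\<close>.
\<close>

lemma wasserstein_star:
  assumes star: "star_graph V E u" and fin: "finite V" and v: "v \<in> V - {u}"
    and pos: "\<And>e. e \<in> E \<Longrightarrow> 0 < w e"
    and \<alpha>: "1 / 2 \<le> \<alpha>" "\<alpha> < 1"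
  defines "S \<equiv> \<Sum>z\<in>V - {u}. 1 / w {u, z}"
  shows "wasserstein V E w (lazy_walk (\<lambda>x. 1 / x) E w \<alpha> u) (lazy_walk (\<lambda>x. 1 / x) E w \<alpha> v)
    = \<alpha> * w {u, v} + (1 - \<alpha>) * (real (card (V - {u})) - 2) / S"
proof -
  let ?\<mu> = "lazy_walk (\<lambda>x. 1 / x) E w \<alpha>"
  let ?L = "V - {u}"
  note E = star_graph_structure(1)[OF star] and N = star_graph_structure(2)[OF star]
    and uV = star_graph_structure(3)[OF star]
  have r: "0 < w {u, z}" if "z \<in> ?L" for z using pos E that by blast
  have Spos: "0 < S" unfolding S_def using fin v r by (intro sum_pos) auto
  define p where "p z = (1 - \<alpha>) * (1 / w {u, z} / S)" for z
  have p0: "0 \<le> p z" if "z \<in> ?L" for z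
    using r[OF that] Spos \<alpha> by (simp add: p_def)
  have psum: "(\<Sum>z\<in>?L. p z) = 1 - \<alpha>"
  proof -
    have "(\<Sum>z\<in>?L. p z) = (1 - \<alpha>) * (S / S)"
      unfolding p_def sum_distrib_left[symmetric] sum_divide_distrib[symmetric] S_def ..
    then show ?thesis using Spos by simp
  qed
  have pw: "p z * w {u, z} = (1 - \<alpha>) / S" if "z \<in> ?L" for z
    using r[OF that] by (simp add: p_def)
  have pv: "p v \<le> \<alpha>"
    using member_le_sum[OF v, of p] p0 psum fin \<alpha> by fastforce
  have mu_u: "?\<mu> u z = (if z = u then \<alpha> else p z)" if "z \<in> V" for z
  proof -
    have "{u, z} \<in> E" if "z \<noteq> u" using that \<open>z \<in> V\<close> by (auto simp: E)
    then show ?thesis by (simp add: lazy_walk_def p_def N S_def)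
  qed
  have edge_v: "{v, z} \<in> E \<longleftrightarrow> z = u" for z
    using v unfolding edge_star_iff[OF star] by auto
  then have nv: "neighbours E v = {u}"
    by (simp add: neighbours_def)
  have mu_v: "?\<mu> v z = (if z = v then \<alpha> else if z = u then 1 - \<alpha> else 0)" for z
  proof -
    have "0 < w {v, u}" using r[OF v] by (simp add: insert_commute)
    then show ?thesis using edge_v[of z] by (simp add: lazy_walk_def nv)
  qed
  (* The optimal pair: A leaves the mass p v at v, moves the rest of v's demand out of u, and
     refills u from the other leaves; f falls at full slope along every such move. *)
  define A where "A x y =
     (if x = u then (if y = u then p v else if y = v then \<alpha> - p v else 0)
      else if x = v then (if y = v then p v else 0)
      else if y = u then p x else 0)" for x y
  define f where "f z = (if z = u then 0 else if z = v then - w {u, v} else w {u, z})" for z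
  have V: "V = insert u (insert v (V - {u, v}))" using uV v by auto
  have uv: "u \<noteq> v" using v by auto
  have L: "?L = insert v (V - {u, v})" using v by auto
  have fin': "finite (V - {u, v})" using fin by simp
  have sumV: "(\<Sum>z\<in>V. g z) = g u + g v + (\<Sum>z\<in>V - {u, v}. g z)" for g :: "'a \<Rightarrow> real"
    by (subst V) (use fin' uv in simp)
  have psum': "(\<Sum>z\<in>V - {u, v}. p z) = 1 - \<alpha> - p v"
    using psum unfolding L using fin' by simp
  have pw': "(\<Sum>z\<in>V - {u, v}. p z * w {u, z}) = (real (card ?L) - 1) * ((1 - \<alpha>) / S)"
  proof -
    have "(\<Sum>z\<in>V - {u, v}. p z * w {u, z}) = (\<Sum>z\<in>V - {u, v}. (1 - \<alpha>) / S)"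
      by (intro sum.cong refl pw) auto
    also have "\<dots> = (real (card ?L) - 1) * ((1 - \<alpha>) / S)"
      unfolding L using fin' by simp
    finally show ?thesis .
  qed
  have coupling: "A \<in> couplings V (?\<mu> u) (?\<mu> v)"
    unfolding couplings_def
  proof (intro CollectI conjI ballI)
    show "0 \<le> A x y" if "x \<in> V" "y \<in> V" for x y
      using that p0 pv v by (auto simp: A_def)
    show "(\<Sum>y\<in>V. A x y) = ?\<mu> u x" if "x \<in> V" for x
      unfolding sumV using that uv by (simp add: mu_u A_def)
    show "(\<Sum>x\<in>V. A x y) = ?\<mu> v y" if "y \<in> V" for y
      unfolding sumV using that uv psum' by (simp add: mu_v A_def)
  qed
  have lip: "f x - f y \<le> graph_dist V E w x y" if "x \<in> V" "y \<in> V" for x y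
    using that r[of x] r[of y] r[OF v]
    by (auto simp: graph_dist_star[OF star] hedgehog_dist_def f_def)
  have fu: "(\<Sum>x\<in>V. f x * ?\<mu> u x) = (real (card ?L) - 2) * ((1 - \<alpha>) / S)"
  proof -
    have "(\<Sum>x\<in>V - {u, v}. f x * ?\<mu> u x) = (real (card ?L) - 1) * ((1 - \<alpha>) / S)"
      unfolding pw'[symmetric] by (intro sum.cong) (auto simp: f_def mu_u)
    moreover have "f v * ?\<mu> u v = - ((1 - \<alpha>) / S)"
      using v pw[OF v] by (simp add: f_def mu_u mult.commute)
    moreover have "f u = 0" by (simp add: f_def)
    ultimately show ?thesis unfolding sumV by (simp only: mult_zero_left left_diff_distrib)
  qed
  have fv: "(\<Sum>x\<in>V. f x * ?\<mu> v x) = - \<alpha> * w {u, v}"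
    unfolding sumV using uv by (simp add: f_def mu_v)
  have "(\<Sum>x\<in>V. \<Sum>y\<in>V. A x y * graph_dist V E w x y)
      = (\<alpha> - p v) * w {u, v} + (\<Sum>x\<in>V - {u, v}. p x * w {u, x})"
    unfolding sumV using uv v uV
    by (simp add: A_def graph_dist_star[OF star] hedgehog_dist_def)
  also have "\<dots> = (\<Sum>x\<in>V. f x * ?\<mu> u x) - (\<Sum>x\<in>V. f x * ?\<mu> v x)"
    unfolding fu fv pw' using pw[OF v] by (simp add: algebra_simps)
  finally have "wasserstein V E w (?\<mu> u) (?\<mu> v)
      = (\<Sum>x\<in>V. f x * ?\<mu> u x) - (\<Sum>x\<in>V. f x * ?\<mu> v x)"
    by (intro wasserstein_eqI[OF coupling lip])
  then show ?thesis by (simp add: fu fv mult.commute)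
qed

text \<open>
  The transport cost is affine in \<open>\<alpha>\<close> near 1, so the quotient defining the curvature is constant
  there and the limit is its value.
\<close>

lemma edge_curvature_star:
  assumes star: "star_graph V E u" and fin: "finite V" and v: "v \<in> V - {u}"
    and pos: "\<And>e. e \<in> E \<Longrightarrow> 0 < w e"
  shows "edge_curvature (\<lambda>x. 1 / x) V E w {u, v}
    = 1 - (real (card (V - {u})) - 2) / ((\<Sum>z\<in>V - {u}. 1 / w {u, z}) * w {u, v})"
    (is "_ = ?\<kappa>")
proof -
  let ?\<mu> = "lazy_walk (\<lambda>x. 1 / x) E w"
  define S where "S = (\<Sum>z\<in>V - {u}. 1 / w {u, z})"
  have r: "0 < w {u, z}" if "z \<in> V - {u}" for z
  proof -
    have "{u, z} \<in> E" using that edge_star_iff[OF star, of u z] by blast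
    then show ?thesis by (rule pos)
  qed
  have Spos: "0 < S"
    unfolding S_def using fin v r by (intro sum_pos) auto
  have wv: "0 < w {u, v}" using r[OF v] .
  have comm: "graph_dist V E w x y = graph_dist V E w y x" if "x \<in> V" "y \<in> V" for x y
    using that by (simp add: graph_dist_star[OF star] hedgehog_dist_def)
  have dist: "graph_dist V E w u v = w {u, v}" "graph_dist V E w v u = w {u, v}"
    using v star_graph_structure(3)[OF star]
    by (auto simp: graph_dist_star[OF star] hedgehog_dist_def)
  have W: "wasserstein V E w (?\<mu> \<alpha> x) (?\<mu> \<alpha> y)
      = \<alpha> * w {u, v} + (1 - \<alpha>) * (real (card (V - {u})) - 2) / (\<Sum>z\<in>V - {u}. 1 / w {u, z})"
    if "1 / 2 \<le> \<alpha>" "\<alpha> < 1" "(x, y) \<in> {(u, v), (v, u)}" for \<alpha> x y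
  proof -
    have "wasserstein V E w (?\<mu> \<alpha> x) (?\<mu> \<alpha> y) = wasserstein V E w (?\<mu> \<alpha> u) (?\<mu> \<alpha> v)"
      using that(3) wasserstein_commute[OF comm] by blast
    also note wasserstein_star[OF star fin v pos that(1,2)]
    finally show ?thesis .
  qed
  have lim: "olly_curvature (\<lambda>x. 1 / x) V E w x y = ?\<kappa>" if xy: "(x, y) \<in> {(u, v), (v, u)}" for x y
  proof -
    have key: "alpha_curvature (\<lambda>x. 1 / x) V E w \<alpha> x y / (1 - \<alpha>) = ?\<kappa>"
      if "1 / 2 \<le> \<alpha>" "\<alpha> < 1" for \<alpha>
    proof -
      have "alpha_curvature (\<lambda>x. 1 / x) V E w \<alpha> x y = (1 - \<alpha>) * ?\<kappa>"
      proof -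
        have d: "graph_dist V E w x y = w {u, v}" using xy dist by auto
        have "1 - (\<alpha> * b + (1 - \<alpha>) * c / S) / b = (1 - \<alpha>) * (1 - c / (S * b))"
          if "0 < b" for b c
        proof -
          have "(\<alpha> * b + (1 - \<alpha>) * c / S) / b = \<alpha> + (1 - \<alpha>) * (c / (S * b))"
            using that by (simp add: add_divide_distrib)
          then show ?thesis by (simp add: algebra_simps)
        qed
        from this[OF wv] show ?thesis
          unfolding alpha_curvature_def W[OF that xy] d S_def .
      qed
      moreover have "1 - \<alpha> \<noteq> 0" using that(2) by simp
      ultimately show ?thesis by (simp only: nonzero_mult_div_cancel_left not_False_eq_True)
    qed
    have "eventually (\<lambda>\<alpha>. alpha_curvature (\<lambda>x. 1 / x) V E w \<alpha> x y / (1 - \<alpha>) = ?\<kappa>) (at_left 1)"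
      by (rule eventually_at_leftI[of "1/2"], rule key) simp_all
    then have "((\<lambda>\<alpha>. alpha_curvature (\<lambda>x. 1 / x) V E w \<alpha> x y / (1 - \<alpha>)) \<longlongrightarrow> ?\<kappa>) (at_left 1)"
      by (rule tendsto_eventually)
    then show ?thesis
      unfolding olly_curvature_def by (intro tendsto_Lim) simp_all
  qed
  show ?thesis
    unfolding edge_curvature_def
  proof (rule the_equality)
    show "\<exists>x y. {u, v} = {x, y} \<and> x \<noteq> y \<and> ?\<kappa> = olly_curvature (\<lambda>x. 1 / x) V E w x y"
      by (rule exI[of _ u], rule exI[of _ v]) (use v lim[of u v] in auto)
  next
    fix k assume "\<exists>x y. {u, v} = {x, y} \<and> x \<noteq> y \<and> k = olly_curvature (\<lambda>x. 1 / x) V E w x y"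
    then obtain x y where xy: "{u, v} = {x, y}" and k: "k = olly_curvature (\<lambda>x. 1 / x) V E w x y"
      by (elim exE conjE)
    have "(x, y) \<in> {(u, v), (v, u)}"
      using xy unfolding doubleton_eq_iff by blast
    then show "k = ?\<kappa>" unfolding k by (rule lim)
  qed
qed

section \<open>Linear and separable differential equations\<close>

text \<open>
  Gronwall's estimate: the square of \<open>z\<close> times \<open>exp (2 k r)\<close> has nonpositive derivative. Negative
  \<open>k\<close> gives uniqueness of the zero solution, \<open>k = 0\<close> monotonicity of \<open>\<bar>z\<bar>\<close>, and positive \<open>k\<close>
  exponential decay.
\<close>

lemma linear_ode_decay:
  fixes z c :: "real \<Rightarrow> real"
  assumes "0 \<le> s" "s \<le> t"
    and deriv: "\<And>r. s \<le> r \<Longrightarrow> r \<le> t \<Longrightarrow> (z has_real_derivative - c r * z r) (at r within {0..})"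
    and rate: "\<And>r. s \<le> r \<Longrightarrow> r \<le> t \<Longrightarrow> k \<le> c r"
  shows "\<bar>z t\<bar> \<le> \<bar>z s\<bar> * exp (- k * (t - s))"
proof -
  define h where "h r = (z r)\<^sup>2 * exp (2 * k * r)" for r
  have h_deriv: "(h has_real_derivative 2 * ((z r)\<^sup>2 * exp (2 * k * r)) * (k - c r)) (at r within {0..})"
    if "s \<le> r" "r \<le> t" for r
    unfolding h_def
    by (rule derivative_eq_intros deriv[OF that] refl)+ (simp add: algebra_simps power2_eq_square)
  have "h t \<le> h s"
  proof (rule DERIV_nonpos_imp_decreasing_open[OF \<open>s \<le> t\<close>])
    fix r assume r: "s < r" "r < t"
    have "at r within {0..} = at r"
      using r assms(1) by (intro at_within_open_subset[of r "{0<..}"]) auto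
    then have "DERIV h r :> 2 * ((z r)\<^sup>2 * exp (2 * k * r)) * (k - c r)"
      using h_deriv[of r] r by simp
    moreover have "2 * ((z r)\<^sup>2 * exp (2 * k * r)) * (k - c r) \<le> 0"
      using rate[of r] r by (intro mult_nonneg_nonpos) auto
    ultimately show "\<exists>y. DERIV h r :> y \<and> y \<le> 0" by blast
  next
    show "continuous_on {s..t} h"
      by (rule DERIV_continuous_on, rule DERIV_subset[OF h_deriv]) (use assms(1) in auto)
  qed
  then have "(z t)\<^sup>2 * exp (2 * k * t) * exp (- (2 * k * t)) \<le> (z s)\<^sup>2 * exp (2 * k * s) * exp (- (2 * k * t))"
    unfolding h_def by (rule mult_right_mono) simp
  then have "(z t)\<^sup>2 \<le> (z s)\<^sup>2 * (exp (- k * (t - s)))\<^sup>2"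
    by (simp add: mult.assoc power2_eq_square[of "exp _"] algebra_simps flip: exp_add)
  then show ?thesis
    unfolding power_mult_distrib[symmetric] abs_le_square_iff[symmetric]
    by (simp only: abs_mult abs_exp_cancel)
qed

text \<open>
  This is what separation of variables needs: if \<open>G\<close> is an antiderivative of \<open>g\<close>, then
  \<open>t \<mapsto> h (G 0 + k t)\<close> solves \<open>\<tau>' = k / g \<tau>\<close> wherever its argument lies in the range of \<open>G\<close>.
\<close>

lemma increasing_inverse_derivative:
  fixes G g :: "real \<Rightarrow> real"
  assumes deriv: "\<And>x. l < x \<Longrightarrow> (G has_real_derivative g x) (at x)"
    and pos: "\<And>x. l < x \<Longrightarrow> 0 < g x"
  obtains h where "\<And>x. l < x \<Longrightarrow> h (G x) = x"
    and "\<And>x. l < x \<Longrightarrow> (h has_real_derivative inverse (g x)) (at (G x))"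
proof -
  have mono: "G x < G y" if "l < x" "x < y" for x y
  proof (rule DERIV_pos_imp_increasing[OF that(2)])
    fix r assume "x \<le> r" "r \<le> y"
    then have "l < r" using that(1) by simp
    then show "\<exists>D. (G has_real_derivative D) (at r) \<and> 0 < D" using deriv pos by blast
  qed
  then have inj: "inj_on G {l<..}"
    by (intro linorder_inj_onI) (auto dest: less_imp_neq)
  define h where "h = inv_into {l<..} G"
  have hG: "h (G x) = x" if "l < x" for x
    using inj that by (simp add: h_def)
  have "(h has_real_derivative inverse (g x)) (at (G x))" if x: "l < x" for x
  proof -
    define d where "d = (x - l) / 2"
    have d: "0 < d" "l < x - d" using x by (auto simp: d_def field_simps)
    have cont: "isCont G z" if "l < z" for z
      using deriv[OF that] by (rule DERIV_isCont)
    have "isCont h (G x)"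
    proof (rule isCont_inverse_function[where f = G and x = x, OF d(1)])
      fix z assume "\<bar>z - x\<bar> \<le> d"
      then have z: "l < z" using d(2) by (simp add: abs_le_iff)
      show "h (G z) = z" by (rule hG[OF z])
      show "isCont G z" by (rule cont[OF z])
    qed
    moreover have "G (h y) = y" if "G (x - d) < y" "y < G (x + d)" for y
    proof -
      have "\<exists>z. x - d \<le> z \<and> z \<le> x + d \<and> G z = y"
        using that d by (intro IVT) (auto intro!: cont)
      then obtain z where "x - d \<le> z" "G z = y" by blast
      then show ?thesis using d hG[of z] by simp
    qed
    moreover have "(G has_real_derivative g x) (at (h (G x)))" "g x \<noteq> 0"
      using deriv[OF x] pos[OF x] hG[OF x] by simp_all
    moreover have "G (x - d) < G x" "G x < G (x + d)"
      using mono d x by simp_all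
    ultimately show ?thesis
      by (intro DERIV_inverse_function[where f = G and a = "G (x - d)" and b = "G (x + d)"])
  qed
  with hG show thesis by (rule that)
qed

section \<open>The flow on the simplex\<close>

text \<open>
  Put \<open>d = card L\<close>, \<open>a = 1 / d\<close> and \<open>c i = x0 i - a\<close>. In the ansatz \<open>x t i = a + c i exp (- T t)\<close> the system
  becomes \<open>T' = k d / S\<close>, where the sum of reciprocals is
  \<open>S = d g(T)\<close> and \<open>g\<close> is the derivative of
  \<open>G \<tau> = \<Sum>i. ln (a exp \<tau> + c i)\<close>. Hence \<open>G (T t) = G 0 + k t\<close>, and this can be solved for all
  \<open>t \<ge> 0\<close> because \<open>G\<close> increases to infinity.
\<close>

lemma simplex_flow_exists:
  fixes x0 :: "'i \<Rightarrow> real" and L :: "'i set"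
  assumes fin: "finite L" and ne: "L \<noteq> {}" and k: "0 \<le> k"
    and pos: "\<And>i. i \<in> L \<Longrightarrow> 0 < x0 i" and sum1: "(\<Sum>i\<in>L. x0 i) = 1"
  shows "\<exists>x. (\<forall>i\<in>L. x 0 i = x0 i) \<and> (\<forall>t\<ge>0. (\<Sum>i\<in>L. x t i) = 1 \<and> (\<forall>i\<in>L. 0 < x t i \<and>
    ((\<lambda>s. x s i) has_real_derivative
       k / (\<Sum>j\<in>L. 1 / x t j) * (1 - real (card L) * x t i)) (at t within {0..})))"
proof -
  define a where "a = 1 / real (card L)"
  have card: "0 < card L" using fin ne by (simp add: card_gt_0_iff)
  have a: "0 < a" "a \<le> 1" "real (card L) * a = 1" using card by (auto simp: a_def)
  define c where "c i = x0 i - a" for i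
  have csum: "(\<Sum>i\<in>L. c i) = 0" using sum1 a by (simp add: c_def sum_subtractf)
  define m where "m = Min (x0 ` L)"
  have m: "0 < m" "\<And>i. i \<in> L \<Longrightarrow> m \<le> x0 i"
    using fin ne pos by (auto simp: m_def)
  (* The domain of G is extended a little below 0, to make 0 an interior point: then the inverse
     of G is differentiable also at G 0. *)
  have pos': "0 < a * exp \<tau> + c i" if "i \<in> L" "- m < \<tau>" for i \<tau>
  proof -
    have "a * (1 - exp \<tau>) < m"
    proof (cases "\<tau> \<ge> 0")
      case True
      then have "a * (1 - exp \<tau>) \<le> 0" using a by (intro mult_nonneg_nonpos) auto
      then show ?thesis using m by simp
    next
      case False
      have "a * (1 - exp \<tau>) \<le> 1 * (1 - exp \<tau>)"
        using False a by (intro mult_right_mono) auto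
      also have "\<dots> \<le> - \<tau>" using exp_ge_add_one_self[of \<tau>] unfolding mult_1 by linarith
      also have "\<dots> < m" using that(2) by simp
      finally show ?thesis .
    qed
    then show ?thesis using m(2)[OF that(1)] by (simp add: c_def algebra_simps)
  qed
  define G where "G \<tau> = (\<Sum>i\<in>L. ln (a * exp \<tau> + c i))" for \<tau>
  define g where "g \<tau> = (\<Sum>i\<in>L. a * exp \<tau> / (a * exp \<tau> + c i))" for \<tau>
  have G_deriv: "(G has_real_derivative g \<tau>) (at \<tau>)" if "- m < \<tau>" for \<tau>
    unfolding G_def g_def
    by (rule DERIV_sum) (auto intro!: derivative_eq_intros pos' that)
  have g_pos: "0 < g \<tau>" if "- m < \<tau>" for \<tau>
    unfolding g_def using fin ne a pos'[OF _ that] by (intro sum_pos) auto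
  obtain h where hG: "\<And>\<tau>. - m < \<tau> \<Longrightarrow> h (G \<tau>) = \<tau>"
    and h_deriv: "\<And>\<tau>. - m < \<tau> \<Longrightarrow> (h has_real_derivative inverse (g \<tau>)) (at (G \<tau>))"
    using increasing_inverse_derivative[of "- m" G g] G_deriv g_pos by blast
  have G_onto: "\<exists>\<tau>\<ge>0. G \<tau> = y" if y: "G 0 \<le> y" for y
  proof -
    (* q exp \<tau> bounds every argument of ln in G from below, so G grows at least linearly. *)
    define q where "q = min a m"
    have q: "0 < q" using a m by (simp add: q_def)
    define \<tau> where "\<tau> = max 0 (y / real (card L) - ln q)"
    have "y \<le> real (card L) * (ln q + \<tau>)"
    proof -
      have "y = real (card L) * (y / real (card L))" using card by simp
      also have "\<dots> \<le> real (card L) * (ln q + \<tau>)"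
        by (intro mult_left_mono) (auto simp: \<tau>_def)
      finally show ?thesis .
    qed
    also have "\<dots> = (\<Sum>i\<in>L. ln (q * exp \<tau>))"
      using q by (simp add: ln_mult)
    also have "\<dots> \<le> G \<tau>"
      unfolding G_def
    proof (intro sum_mono)
      fix i assume i: "i \<in> L"
      have "q * exp \<tau> \<le> a * exp \<tau> + c i"
      proof (cases "0 \<le> c i")
        case True
        then show ?thesis by (intro add_increasing2 mult_right_mono) (auto simp: q_def)
      next
        case False
        have "q * exp \<tau> \<le> (a + c i) * exp \<tau>"
          using m(2)[OF i] by (intro mult_right_mono) (auto simp: q_def c_def)
        also have "\<dots> \<le> a * exp \<tau> + c i"
          using False mult_left_mono_neg[of 1 "exp \<tau>" "c i"]
          by (simp add: distrib_right \<tau>_def)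
        finally show ?thesis .
      qed
      then show "ln (q * exp \<tau>) \<le> ln (a * exp \<tau> + c i)"
        using q by (intro ln_mono) auto
    qed
    finally have "y \<le> G \<tau>" .
    moreover have "isCont G \<sigma>" if "0 \<le> \<sigma>" for \<sigma>
      using G_deriv[of \<sigma>] that m by (intro DERIV_isCont) auto
    ultimately show ?thesis
      using y IVT[of G 0 y \<tau>] by (auto simp: \<tau>_def)
  qed
  define T where "T t = h (G 0 + k * t)" for t
  define x where "x t i = a + c i * exp (- T t)" for t i
  have "x 0 i = x0 i" for i
    using hG[of 0] m by (simp add: x_def T_def c_def)
  moreover have "(\<Sum>i\<in>L. x t i) = 1" for t
    using a csum by (simp add: x_def sum.distrib flip: sum_distrib_right)
  moreover have "0 < x t i" "((\<lambda>s. x s i) has_real_derivative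
       k / (\<Sum>j\<in>L. 1 / x t j) * (1 - real (card L) * x t i)) (at t within {0..})"
    if t: "0 \<le> t" and i: "i \<in> L" for t i
  proof -
    have "G 0 \<le> G 0 + k * t" using k t by simp
    then obtain \<tau> where \<tau>: "0 \<le> \<tau>" "G \<tau> = G 0 + k * t" using G_onto by blast
    have m\<tau>: "- m < \<tau>" using \<tau> m by simp
    have T: "T t = \<tau>" using hG[OF m\<tau>] \<tau> by (simp add: T_def)
    have x_eq: "x t j = (a * exp \<tau> + c j) / exp \<tau>" for j
      by (simp add: x_def T exp_minus field_simps)
    show "0 < x t i" using pos'[OF i m\<tau>] by (simp add: x_eq)
    have S: "(\<Sum>j\<in>L. 1 / x t j) = real (card L) * g \<tau>"
      unfolding g_def sum_distrib_left x_eq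
      using a by (intro sum.cong refl) (simp add: mult.assoc[symmetric])
    have T_deriv: "(T has_real_derivative k / g \<tau>) (at t)"
    proof -
      have "((\<lambda>t. h (G 0 + k * t)) has_real_derivative inverse (g \<tau>) * k) (at t)"
        using h_deriv[OF m\<tau>] unfolding \<tau>(2)
        by (rule DERIV_chain2) (auto intro!: derivative_eq_intros)
      then show ?thesis by (simp add: T_def[abs_def] field_simps)
    qed
    have "((\<lambda>s. x s i) has_real_derivative - c i * exp (- \<tau>) * (k / g \<tau>)) (at t)"
      unfolding x_def by (auto intro!: derivative_eq_intros T_deriv simp: T)
    moreover have "1 - real (card L) * x t i = real (card L) * (- c i * exp (- \<tau>))"
      using a(3) by (simp add: x_def T distrib_left)
    then have "k / (\<Sum>j\<in>L. 1 / x t j) * (1 - real (card L) * x t i) = - c i * exp (- \<tau>) * (k / g \<tau>)"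
      unfolding S using card by simp
    ultimately show "((\<lambda>s. x s i) has_real_derivative
       k / (\<Sum>j\<in>L. 1 / x t j) * (1 - real (card L) * x t i)) (at t within {0..})"
      by (simp add: has_field_derivative_at_within)
  qed
  ultimately show ?thesis by blast
qed

section \<open>Convergence of arbitrary solutions\<close>

text \<open>
  Summing the equations gives \<open>(\<sigma> - 1)' = (\<sigma> - d H) (\<sigma> - 1)\<close> for the total weight \<open>\<sigma>\<close>,
  where \<open>d = card L\<close> and \<open>H = k / S\<close> with \<open>S\<close> the sum of the reciprocals. The growth rate
  \<open>\<sigma> - d H\<close> is at most \<open>\<sigma>\<close>, which is bounded on a compact time interval, so \<open>\<sigma> - 1\<close> remains 0.
\<close>

lemma star_flow_total_weight:
  fixes x :: "real \<Rightarrow> 'i \<Rightarrow> real"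
  assumes fin: "finite L" and k: "0 \<le> k"
    and pos: "\<And>t i. 0 \<le> t \<Longrightarrow> i \<in> L \<Longrightarrow> 0 < x t i"
    and deriv: "\<And>t i. 0 \<le> t \<Longrightarrow> i \<in> L \<Longrightarrow> ((\<lambda>s. x s i) has_real_derivative
       k / (\<Sum>j\<in>L. 1 / x t j) - x t i
       + x t i * ((\<Sum>j\<in>L. x t j) - real (card L) * (k / (\<Sum>j\<in>L. 1 / x t j)))) (at t within {0..})"
    and init: "(\<Sum>i\<in>L. x 0 i) = 1" and t: "0 \<le> t"
  shows "(\<Sum>i\<in>L. x t i) = 1"
proof -
  define \<sigma> where "\<sigma> t = (\<Sum>i\<in>L. x t i)" for t
  define c where "c t = real (card L) * (k / (\<Sum>j\<in>L. 1 / x t j)) - \<sigma> t" for t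
  have \<sigma>_deriv: "(\<sigma> has_real_derivative - c t * (\<sigma> t - 1)) (at t within {0..})"
    if "0 \<le> t" for t
  proof -
    define H where "H = k / (\<Sum>j\<in>L. 1 / x t j)"
    have "(\<sigma> has_real_derivative (\<Sum>i\<in>L. H - x t i + x t i * (\<sigma> t - real (card L) * H)))
        (at t within {0..})"
      unfolding \<sigma>_def[abs_def] H_def by (rule DERIV_sum) (rule deriv[OF that])
    also have "(\<Sum>i\<in>L. H - x t i + x t i * (\<sigma> t - real (card L) * H)) = - c t * (\<sigma> t - 1)"
      unfolding sum.distrib sum_subtractf sum_distrib_right[symmetric]
      by (simp add: \<sigma>_def[symmetric] c_def H_def[symmetric] algebra_simps)
    finally show ?thesis .
  qed
  have "continuous_on {0..t} \<sigma>"
    by (rule DERIV_continuous_on, rule DERIV_subset[OF \<sigma>_deriv]) auto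
  then obtain q where "\<forall>r\<in>{0..t}. \<sigma> r \<le> \<sigma> q"
    using continuous_attains_sup[of "{0..t}" \<sigma>] t by auto
  then obtain K where K: "\<And>r. r \<in> {0..t} \<Longrightarrow> \<sigma> r \<le> K"
    by blast
  have "\<bar>\<sigma> t - 1\<bar> \<le> \<bar>\<sigma> 0 - 1\<bar> * exp (- (- K) * (t - 0))"
  proof (rule linear_ode_decay[OF order_refl t])
    fix r assume r: "0 \<le> r" "r \<le> t"
    show "((\<lambda>s. \<sigma> s - 1) has_real_derivative - c r * (\<sigma> r - 1)) (at r within {0..})"
      using DERIV_diff[OF \<sigma>_deriv[OF r(1)] DERIV_const[of 1]] by simp
    have "0 \<le> (\<Sum>j\<in>L. 1 / x r j)"
      using pos[OF r(1)] by (intro sum_nonneg) (auto intro: less_imp_le)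
    then have "0 \<le> real (card L) * (k / (\<Sum>j\<in>L. 1 / x r j))"
      using k by simp
    then show "- K \<le> c r" using K[of r] r by (simp add: c_def)
  qed
  then show ?thesis using init by (simp add: \<sigma>_def)
qed

text \<open>
  Every deviation \<open>y\<close> from \<open>1 / d\<close> obeys \<open>y' = - c(t) y\<close> with \<open>c(t) = d k / S(t)\<close>. The decay rate
  \<open>c\<close> could degenerate only if some weight tended to 0, making \<open>S\<close> unbounded. This is
  excluded: \<open>\<bar>y\<bar>\<close> does not increase and \<open>y\<close> does not change sign, so each weight stays between
  its initial value and \<open>1 / d\<close>.
\<close>

lemma simplex_flow_tendsto:
  fixes x :: "real \<Rightarrow> 'i \<Rightarrow> real"
  assumes fin: "finite L" and k: "0 < k"
    and pos: "\<And>t i. 0 \<le> t \<Longrightarrow> i \<in> L \<Longrightarrow> 0 < x t i"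
    and deriv: "\<And>t i. 0 \<le> t \<Longrightarrow> i \<in> L \<Longrightarrow> ((\<lambda>s. x s i) has_real_derivative
       k / (\<Sum>j\<in>L. 1 / x t j) * (1 - real (card L) * x t i)) (at t within {0..})"
    and i: "i \<in> L"
  shows "((\<lambda>t. x t i) \<longlongrightarrow> 1 / real (card L)) at_top"
proof -
  define d where "d = real (card L)"
  have d: "0 < d" using fin i by (auto simp: d_def card_gt_0_iff)
  define y where "y j t = x t j - 1 / d" for j t
  define c where "c t = d * (k / (\<Sum>j\<in>L. 1 / x t j))" for t
  have S_pos: "0 < (\<Sum>j\<in>L. 1 / x t j)" if "0 \<le> t" for t
    using fin i pos[OF that] by (intro sum_pos) auto
  have c_pos: "0 \<le> c t" if "0 \<le> t" for t
    using S_pos[OF that] k d by (simp add: c_def)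
  have y_deriv: "(y j has_real_derivative - c t * y j t) (at t within {0..})"
    if "0 \<le> t" "j \<in> L" for t j
  proof -
    have "H * (1 - d * x t j) = - (d * H) * y j t" for H
      using d by (simp add: y_def algebra_simps)
    then show ?thesis
      using DERIV_diff[OF deriv[OF that] DERIV_const[of "1 / d"]]
      by (simp only: y_def[abs_def] c_def d_def diff_zero)
  qed
  have y_cont: "continuous_on {0..t} (y j)" if "j \<in> L" for j t
    by (rule DERIV_continuous_on, rule DERIV_subset[OF y_deriv]) (use that in auto)
  have y_mono: "\<bar>y j t\<bar> \<le> \<bar>y j s\<bar>" if "0 \<le> s" "s \<le> t" "j \<in> L" for s t j
    using linear_ode_decay[where z = "y j" and c = c and k = 0, OF that(1,2)] y_deriv c_pos that
    by force
  define m where "m = Min (insert (1 / d) (x 0 ` L))"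
  have m: "0 < m" "m \<le> 1 / d" "\<And>j. j \<in> L \<Longrightarrow> m \<le> x 0 j"
    using fin pos[of 0] d by (auto simp: m_def)
  (* A sign change would make y vanish at some time, and then for ever since its modulus does not
     increase. *)
  have lower: "m \<le> x t j" if t: "0 \<le> t" and j: "j \<in> L" for t j
  proof (cases "0 \<le> y j t")
    case True
    then show ?thesis using m(2) by (simp add: y_def)
  next
    case False
    have "y j 0 \<le> 0"
    proof (rule ccontr)
      assume "\<not> y j 0 \<le> 0"
      then obtain s where "0 \<le> s" "s \<le> t" "y j s = 0"
        using IVT2'[of "y j" t 0 0] False t y_cont[OF j] by auto
      then show False using y_mono[of s t j] j False by simp
    qed
    then show ?thesis using y_mono[of 0 t j] False t j m(3)[OF j] by (simp add: y_def)
  qed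
  have rate: "k * m \<le> c t" if "0 \<le> t" for t
  proof -
    have "(\<Sum>j\<in>L. 1 / x t j) \<le> (\<Sum>j\<in>L. 1 / m)"
      using lower[OF that] m pos[OF that] by (intro sum_mono divide_left_mono) auto
    then have "m * (\<Sum>j\<in>L. 1 / x t j) \<le> d"
      using m by (simp add: d_def field_simps)
    then have "k * (m * (\<Sum>j\<in>L. 1 / x t j)) \<le> k * d"
      using k by (intro mult_left_mono) auto
    then show ?thesis
      using S_pos[OF that] by (simp add: c_def field_simps)
  qed
  have bound: "\<bar>y i t\<bar> \<le> \<bar>y i 0\<bar> * exp (- (k * m) * t)" if "0 \<le> t" for t
    using linear_ode_decay[where z = "y i" and c = c and k = "k * m", OF order_refl that]
      y_deriv[OF _ i] rate by simp
  have "((\<lambda>t. exp (- (k * m) * t)) \<longlongrightarrow> 0) at_top"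
    using k m
    by (intro filterlim_compose[OF exp_at_bot] filterlim_tendsto_neg_mult_at_bot[OF tendsto_const]
        filterlim_ident) auto
  then have "(y i \<longlongrightarrow> 0) at_top"
    by (rule tendsto_0_le[where K = "\<bar>y i 0\<bar>"])
      (use bound in \<open>auto simp: eventually_at_top_linorder mult.commute intro!: exI[of _ 0]\<close>)
  then have "((\<lambda>t. y i t + 1 / d) \<longlongrightarrow> 0 + 1 / d) at_top"
    by (intro tendsto_add tendsto_const)
  then show ?thesis by (simp add: y_def d_def)
qed

section \<open>The Ricci flow of a star\<close>

text \<open>
  By the curvature formula \<open>\<kappa>\<^sub>v x\<^sub>v = x\<^sub>v - k / S\<close>, which is what enters the flow equation twice. The
  formula is valid for positive weights only, so positivity is kept on both sides.
\<close>

lemma normalized_ricci_flow_star_iff: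
  assumes star: "star_graph V E u" and fin: "finite V"
  defines "L \<equiv> V - {u}"
  defines "k \<equiv> real (card L) - 2"
  shows "normalized_ricci_flow (\<lambda>x. 1 / x) V E w \<longleftrightarrow>
    (\<forall>t\<ge>0. \<forall>v\<in>L. 0 < w t {u, v} \<and>
      ((\<lambda>s. w s {u, v}) has_real_derivative
         k / (\<Sum>z\<in>L. 1 / w t {u, z}) - w t {u, v}
         + w t {u, v} * ((\<Sum>z\<in>L. w t {u, z})
             - real (card L) * (k / (\<Sum>z\<in>L. 1 / w t {u, z})))) (at t within {0..}))"
proof -
  note E = star_graph_structure(1)[OF star, folded L_def]
  define F where "F t v = k / (\<Sum>z\<in>L. 1 / w t {u, z}) - w t {u, v}
      + w t {u, v} * ((\<Sum>z\<in>L. w t {u, z}) - real (card L) * (k / (\<Sum>z\<in>L. 1 / w t {u, z})))"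
    for t v
  let ?\<kappa> = "\<lambda>t. edge_curvature (\<lambda>x. 1 / x) V E (w t)"
  have rhs: "- ?\<kappa> t {u, v} * w t {u, v} + w t {u, v} * (\<Sum>h\<in>E. ?\<kappa> t h * w t h) = F t v"
    if pos: "\<forall>z\<in>L. 0 < w t {u, z}" and v: "v \<in> L" for t v
  proof -
    define S where "S = (\<Sum>z\<in>L. 1 / w t {u, z})"
    have \<kappa>: "?\<kappa> t {u, z} * w t {u, z} = w t {u, z} - k / S" if z: "z \<in> L" for z
    proof -
      have "0 < w t e" if "e \<in> E" for e using that pos unfolding E by blast
      from edge_curvature_star[OF star fin z[unfolded L_def], of "w t", OF this]
      have "?\<kappa> t {u, z} = 1 - k / (S * w t {u, z})"
        by (simp only: k_def S_def L_def)
      moreover have "0 < w t {u, z}" using pos z by blast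
      ultimately show ?thesis by (simp add: left_diff_distrib)
    qed
    have "inj_on (\<lambda>v. {u, v}) L" by (auto simp: inj_on_def doubleton_eq_iff)
    then have "(\<Sum>h\<in>E. ?\<kappa> t h * w t h) = (\<Sum>z\<in>L. ?\<kappa> t {u, z} * w t {u, z})"
      unfolding E by (rule sum.reindex[unfolded o_def])
    also have "\<dots> = (\<Sum>z\<in>L. w t {u, z} - k / S)"
      by (intro sum.cong refl \<kappa>)
    also have "\<dots> = (\<Sum>z\<in>L. w t {u, z}) - real (card L) * (k / S)"
      by (simp add: sum_subtractf)
    finally show ?thesis
      unfolding F_def minus_mult_left[symmetric] \<kappa>[OF v] S_def[symmetric] by simp
  qed
  have iff: "(\<forall>e\<in>E. 0 < w t e \<and> ((\<lambda>s. w s e) has_real_derivative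
          - ?\<kappa> t e * w t e + w t e * (\<Sum>h\<in>E. ?\<kappa> t h * w t h)) (at t within {0..}))
      \<longleftrightarrow> (\<forall>v\<in>L. 0 < w t {u, v} \<and> ((\<lambda>s. w s {u, v}) has_real_derivative F t v) (at t within {0..}))"
    (is "?A \<longleftrightarrow> ?B") for t
  proof -
    have "?A \<longleftrightarrow> (\<forall>v\<in>L. 0 < w t {u, v} \<and> ((\<lambda>s. w s {u, v}) has_real_derivative
          - ?\<kappa> t {u, v} * w t {u, v} + w t {u, v} * (\<Sum>h\<in>E. ?\<kappa> t h * w t h)) (at t within {0..}))"
      by (subst (1) E) (simp only: ball_simps)
    also have "\<dots> \<longleftrightarrow> ?B"
    proof (cases "\<forall>z\<in>L. 0 < w t {u, z}")
      case True
      show ?thesis by (intro ball_cong refl) (simp only: rhs[OF True])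
    qed blast
    finally show ?thesis .
  qed
  show ?thesis
    unfolding normalized_ricci_flow_def iff F_def ..
qed

theorem theorem5:
  fixes V :: "'a set" and E :: "'a set set" and u :: 'a
    and w0 :: "'a set \<Rightarrow> real" and \<gamma> :: "real \<Rightarrow> real"
  assumes "\<gamma> = (\<lambda>x. 1 / x)"
    and "star_graph V E u"
    and "finite (neighbours E u)"
    and "3 \<le> vertex_degree E u"
    and "\<forall>e\<in>E. 0 < w0 e"
    and "(\<Sum>e\<in>E. w0 e) = 1"
  shows "(\<exists>w. normalized_ricci_flow \<gamma> V E w \<and> (\<forall>e\<in>E. w 0 e = w0 e)) \<and>
         (\<forall>w. normalized_ricci_flow \<gamma> V E w \<and> (\<forall>e\<in>E. w 0 e = w0 e) \<longrightarrow>
            (\<forall>e\<in>E. ((\<lambda>t. w t e) \<longlongrightarrow> 1 / real (vertex_degree E u)) at_top))"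
proof -
  note star = assms(2)
  define L where "L = V - {u}"
  define k where "k = real (card L) - 2"
  note E = star_graph_structure(1)[OF star, folded L_def]
  have N: "neighbours E u = L"
    using star_graph_structure(2)[OF star] by (simp only: L_def)
  have degree: "vertex_degree E u = card L"
    by (simp only: vertex_degree_def N)
  have finL: "finite L" using assms(3) unfolding N .
  then have finV: "finite V" by (simp add: L_def)
  have k: "0 < k" using assms(4) unfolding degree k_def by linarith
  have ne: "L \<noteq> {}" using assms(4) unfolding degree by auto
  have inj: "inj_on (\<lambda>v. {u, v}) L" by (auto simp: inj_on_def doubleton_eq_iff)
  note flow_iff = normalized_ricci_flow_star_iff[OF star finV, folded L_def, folded k_def]
  have total0: "(\<Sum>v\<in>L. w0 {u, v}) = 1"
  proof -
    have "(\<Sum>e\<in>E. w0 e) = (\<Sum>v\<in>L. w0 {u, v})"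
      unfolding E using inj by (rule sum.reindex[unfolded o_def])
    then show ?thesis using assms(6) by simp
  qed
  have pos0: "0 < w0 {u, v}" if "v \<in> L" for v
    using assms(5) that unfolding E by blast
  have reduce: "H - y + y * (1 - real (card L) * H) = H * (1 - real (card L) * y)" for H y :: real
    by (simp add: algebra_simps)
  have "\<exists>w. normalized_ricci_flow \<gamma> V E w \<and> (\<forall>e\<in>E. w 0 e = w0 e)"
  proof -
    obtain x where x0: "\<forall>v\<in>L. x 0 v = w0 {u, v}"
      and x: "\<forall>t\<ge>0. (\<Sum>v\<in>L. x t v) = 1 \<and> (\<forall>v\<in>L. 0 < x t v \<and>
        ((\<lambda>s. x s v) has_real_derivative
          k / (\<Sum>z\<in>L. 1 / x t z) * (1 - real (card L) * x t v)) (at t within {0..}))"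
      using simplex_flow_exists[OF finL ne less_imp_le[OF k], of "\<lambda>v. w0 {u, v}"] pos0 total0
      by blast
    define w where "w t e = x t (inv_into L (\<lambda>v. {u, v}) e)" for t e
    have w: "w t {u, v} = x t v" if "v \<in> L" for t v
      unfolding w_def by (rule arg_cong[OF inv_into_f_f[OF inj that]])
    have sums: "(\<Sum>z\<in>L. 1 / w t {u, z}) = (\<Sum>z\<in>L. 1 / x t z)"
      "(\<Sum>z\<in>L. w t {u, z}) = (\<Sum>z\<in>L. x t z)" for t
      by (simp_all add: w)
    have "normalized_ricci_flow \<gamma> V E w"
      unfolding assms(1) flow_iff
    proof (intro allI impI ballI conjI)
      fix t :: real and v assume t: "0 \<le> t" and v: "v \<in> L"
      show "0 < w t {u, v}" using x t v by (simp add: w)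
      have total: "(\<Sum>z\<in>L. x t z) = 1"
        and deriv: "((\<lambda>s. x s v) has_real_derivative
          k / (\<Sum>z\<in>L. 1 / x t z) * (1 - real (card L) * x t v)) (at t within {0..})"
        using x t v by blast+
      show "((\<lambda>s. w s {u, v}) has_real_derivative
         k / (\<Sum>z\<in>L. 1 / w t {u, z}) - w t {u, v}
         + w t {u, v} * ((\<Sum>z\<in>L. w t {u, z})
             - real (card L) * (k / (\<Sum>z\<in>L. 1 / w t {u, z})))) (at t within {0..})"
        unfolding sums total w[OF v] reduce by (rule deriv)
    qed
    moreover have "\<forall>e\<in>E. w 0 e = w0 e"
      unfolding E using w x0 by simp
    ultimately show ?thesis by blast
  qed
  moreover have "((\<lambda>t. w t e) \<longlongrightarrow> 1 / real (vertex_degree E u)) at_top"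
    if flow: "normalized_ricci_flow \<gamma> V E w" and init: "\<forall>e\<in>E. w 0 e = w0 e" and e: "e \<in> E" for w e
  proof -
    define x where "x t v = w t {u, v}" for t v
    have x: "\<forall>t\<ge>0. \<forall>v\<in>L. 0 < x t v \<and> ((\<lambda>s. x s v) has_real_derivative
         k / (\<Sum>z\<in>L. 1 / x t z) - x t v
         + x t v * ((\<Sum>z\<in>L. x t z) - real (card L) * (k / (\<Sum>z\<in>L. 1 / x t z)))) (at t within {0..})"
      using flow unfolding assms(1) flow_iff x_def .
    have init': "(\<Sum>v\<in>L. x 0 v) = 1"
    proof -
      have "(\<Sum>v\<in>L. x 0 v) = (\<Sum>v\<in>L. w0 {u, v})"
        unfolding x_def using init unfolding E by (intro sum.cong) auto
      then show ?thesis using total0 by simp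
    qed
    have total: "(\<Sum>v\<in>L. x t v) = 1" if "0 \<le> t" for t
      using x by (intro star_flow_total_weight[where x = x, OF finL less_imp_le[OF k] _ _ init' that]) blast+
    obtain v where v: "v \<in> L" "e = {u, v}" using e unfolding E by blast
    have "((\<lambda>t. x t v) \<longlongrightarrow> 1 / real (card L)) at_top"
    proof (rule simplex_flow_tendsto[OF finL k _ _ v(1)])
      fix t :: real and z assume t: "0 \<le> t" and z: "z \<in> L"
      show "0 < x t z" using x t z by blast
      have "((\<lambda>s. x s z) has_real_derivative
         k / (\<Sum>j\<in>L. 1 / x t j) - x t z
         + x t z * ((\<Sum>j\<in>L. x t j) - real (card L) * (k / (\<Sum>j\<in>L. 1 / x t j)))) (at t within {0..})"
        using x t z by blast
      then show "((\<lambda>s. x s z) has_real_derivative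
          k / (\<Sum>j\<in>L. 1 / x t j) * (1 - real (card L) * x t z)) (at t within {0..})"
        unfolding total[OF t] reduce .
    qed
    then show ?thesis by (simp only: x_def v(2) degree)
  qed
  ultimately show ?thesis by blast
qed

end
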